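(* For a natural number $n$, $$\tau(n)=\frac{\displaystyle\sum_{\substack{k=1\\ \gcd(k,n)=1}}^{n}\gcd(k-1,n)}{2\left\{\displaystyle\sum_{j=1}^{n-1}\sum_{k=1}^{n}\left\lfloor\frac{jk}{n}\right\rfloor\,\cos\left(\frac{2k\pi}{n}\right)\right\}-\displaystyle\frac{n(n-1)}{2}} .$$
   Context: $\tau(n)=\sum_{d\mid n}1$ is the number of divisors of the natural number $n$. $\gcd(a,b)$ denotes the greatest common divisor of $a$ and $b$ (so $\gcd(0,n)=n$). $\lfloor x\rfloor$ denotes the integer part (floor) of $x$.
   Formalization: The formula is stated for n ≥ 2: at n = 1 the sum over j is empty and n(n-1)/2 = 0, so the denominator is 0 and the right-hand side is undefined. *)

theory Defs
  imports Complex_Main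
begin

definition tau :: "nat \<Rightarrow> nat" where
  "tau n = (\<Sum>d | d dvd n. 1)"

end

(* The numerator is evaluated by Menon's identity: expand gcd(k-1,n) as the sum of phi(d) over its
   divisors d; the units mod n that are 1 mod d number phi(n)/phi(d), because reduction
   (Z/n)^* -> (Z/d)^* is onto with equal fibres. Hence it equals phi(n) tau(n).
   For the denominator, pair k with n-k in the inner sum: the cosines agree and the two floors add up
   to j-1+[n | jk]. What survives are sums over g-th roots of unity with g = gcd(j,n), which vanish
   unless g = 1, so twice the inner sum is j + [gcd(j,n) = 1], and the denominator is phi(n). *)
theory Submission
  imports Defs "HOL-Number_Theory.Totient"
begin

section \<open>Units modulo n, their reduction modulo a divisor, and Menon's identity\<close>

lemma coprime_lift_to_multiple:
  fixes a d n :: nat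
  assumes "coprime a d" "n > 0"
  obtains u where "coprime u n" "[u = a] (mod d)"
proof
  \<comment> \<open>\<open>t\<close> is chosen so that each prime p dividing n divides exactly one
    of \<open>a\<close> and \<open>d * t\<close>. If p divides \<open>a\<close>, it divides neither
    \<open>d\<close>, by coprimality, nor \<open>t\<close>; otherwise it is a factor of
    \<open>t\<close>.\<close>
  define t where "t = \<Prod>{p \<in> prime_factors n. \<not> p dvd a}"
  show "[a + d * t = a] (mod d)"
    by (simp add: cong_def)
  show "coprime (a + d * t) n"
  proof (rule ccontr)
    assume "\<not> coprime (a + d * t) n"
    then have "gcd (a + d * t) n \<noteq> 1"
      by (simp only: coprime_iff_gcd_eq_1 not_False_eq_True)
    then obtain p where "prime p" "p dvd gcd (a + d * t) n"
      using prime_factor_nat by blast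
    then have p: "prime p" "p dvd a + d * t" "p dvd n"
      by simp_all
    have pn: "p \<in> prime_factors n"
      using p assms by (auto simp: prime_factors_dvd)
    show False
    proof (cases "p dvd a")
      case True
      then have "p dvd d * t"
        using p(2) dvd_add_right_iff by blast
      moreover have "\<not> p dvd d"
        using True assms(1) p(1) by (meson coprime_common_divisor not_prime_unit)
      ultimately have "p dvd t"
        using p(1) prime_dvd_multD by blast
      then obtain q where q: "q \<in> prime_factors n" "\<not> q dvd a" "p dvd q"
        using p(1) by (auto simp: t_def prime_dvd_prod_iff)
      then have "p = q"
        using p(1) by (auto intro: primes_dvd_imp_eq)
      then show False
        using q True by simp
    next
      case False
      then have "p dvd t"
        unfolding t_def using pn by (intro dvd_prodI) auto
      then have "p dvd a"
        using p(2) by (metis dvd_add_left_iff dvd_mult)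
      then show False
        using False by simp
    qed
  qed
qed

text \<open>Multiplication by the unit u is injective modulo n and carries the class of a modulo d
  into that of a u. An inequality suffices, since the inverse of u supplies the opposite
  one.\<close>

lemma card_totatives_cong_mult_le:
  assumes "d dvd n" "n > 1" "coprime u n"
  shows "card {k \<in> totatives n. [k = a] (mod d)} \<le> card {k \<in> totatives n. [k = a * u] (mod d)}"
proof (rule card_inj_on_le)
  let ?f = "\<lambda>k. k * u mod n"
  show "inj_on ?f {k \<in> totatives n. [k = a] (mod d)}"
  proof (rule inj_onI)
    fix x y assume xy: "x \<in> {k \<in> totatives n. [k = a] (mod d)}" "y \<in> {k \<in> totatives n. [k = a] (mod d)}"
      and eq: "?f x = ?f y"
    have "[x = y] (mod n)"
      using eq assms(3) cong_mult_rcancel_nat by (simp add: cong_def)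
    moreover have "x < n" "y < n"
      using xy assms(2) totatives_less by auto
    ultimately show "x = y"
      by (simp add: cong_less_modulus_unique_nat)
  qed
  show "?f ` {k \<in> totatives n. [k = a] (mod d)} \<subseteq> {k \<in> totatives n. [k = a * u] (mod d)}"
  proof (safe)
    fix k assume k: "k \<in> totatives n" "[k = a] (mod d)"
    have "coprime (k * u mod n) n"
      using k assms by (simp add: in_totatives_iff)
    \<comment> \<open>Totatives are positive, so the residue 0 must be excluded: gcd(0,n) = n >
      1.\<close>
    moreover from this have "k * u mod n > 0"
      using assms(2) by (cases "k * u mod n = 0") auto
    ultimately show "?f k \<in> totatives n"
      using assms(2) by (simp add: in_totatives_iff less_imp_le)
    have "[k * u mod n = k * u] (mod d)"
      using assms(1) by (simp add: cong_def mod_mod_cancel)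
    then show "[?f k = a * u] (mod d)"
      using k(2) cong_scalar_right cong_trans by blast
  qed
qed auto

text \<open>Lift a to a unit u modulo n. Multiplication by u maps the fibre over 1 into the fibre
  over a, and multiplication by the inverse v of u maps it back.\<close>

lemma card_totatives_cong_eq:
  assumes "d dvd n" "n > 1" "coprime a d"
  shows "card {k \<in> totatives n. [k = a] (mod d)} = card {k \<in> totatives n. [k = 1] (mod d)}"
proof -
  let ?N = "\<lambda>a. {k \<in> totatives n. [k = a] (mod d)}"
  have N_cong: "?N b = ?N c" if "[b = c] (mod d)" for b c
    using that by (auto intro: cong_trans cong_sym)
  obtain u where u: "coprime u n" "[u = a] (mod d)"
    using coprime_lift_to_multiple[OF assms(3)] assms(2) by (metis less_trans zero_less_one)
  obtain v where v: "[u * v = 1] (mod n)"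
    using cong_solve_coprime_nat[OF u(1)] by auto
  then have "coprime v n"
    by (metis cong_imp_coprime cong_sym coprime_1_left coprime_mult_left_iff)
  then have "card (?N u) \<le> card (?N (u * v))"
    by (rule card_totatives_cong_mult_le[OF assms(1,2)])
  also have "?N (u * v) = ?N 1"
    using v assms(1) cong_dvd_modulus_nat by (intro N_cong) blast
  finally have "card (?N u) \<le> card (?N 1)" .
  moreover have "card (?N 1) \<le> card (?N u)"
    using card_totatives_cong_mult_le[OF assms(1,2) u(1), of 1] by simp
  ultimately show ?thesis
    using N_cong[OF u(2)] by simp
qed

text \<open>Reduction modulo d splits the units modulo n into fibres indexed by the units modulo d,
  all as large as the fibre over 1.\<close>

lemma totient_mult_card_totatives_cong_1:
  assumes "d dvd n" "n > 1"
  shows "totient d * card {k \<in> totatives n. [k = 1] (mod d)} = totient n"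
proof -
  let ?N = "\<lambda>a. {k \<in> totatives n. [k = a] (mod d)}"
  have d: "d > 0"
    using assms by (auto intro!: Nat.gr0I)
  have "totatives n = (\<Union>a\<in>totatives d. ?N a)"
  proof (safe)
    fix k assume k: "k \<in> totatives n"
    then have "coprime k d"
      using assms(1) coprime_divisors by (auto simp: in_totatives_iff)
    then have c: "coprime (k mod d) d"
      using d by simp
    show "k \<in> (\<Union>a\<in>totatives d. ?N a)"
    \<comment> \<open>For d = 1 the representative in \<open>totatives d\<close> is 1, whereas
      \<open>k mod d\<close> is 0.\<close>
    proof (cases "d = 1")
      case False
      with c have "k mod d > 0"
        by (cases "k mod d = 0") auto
      with c d have "k mod d \<in> totatives d"
        by (simp add: in_totatives_iff less_imp_le)
      then show ?thesis
        using k by (intro UN_I[of "k mod d"]) (auto simp: cong_def)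
    qed (use k in auto)
  qed
  then have "totient n = card (\<Union>a\<in>totatives d. ?N a)"
    by (simp add: totient_def)
  also have "\<dots> = (\<Sum>a\<in>totatives d. card (?N a))"
  proof (rule card_UN_disjoint)
    have "x = y" if "x \<in> totatives d" "y \<in> totatives d" "[k = x] (mod d)" "[k = y] (mod d)" for x y k
    proof (cases "d = 1")
      case False
      then have "x < d" "y < d"
        using that d totatives_less by auto
      then show ?thesis
        using that by (simp add: cong_def)
    qed (use that in auto)
    then show "\<forall>x\<in>totatives d. \<forall>y\<in>totatives d. x \<noteq> y \<longrightarrow> ?N x \<inter> ?N y = {}"
      by blast
  qed auto
  also have "\<dots> = (\<Sum>a\<in>totatives d. card (?N 1))"
    using assms by (intro sum.cong card_totatives_cong_eq) (auto simp: in_totatives_iff)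
  finally show ?thesis
    by (simp add: totient_def)
qed

theorem menon_identity:
  assumes "n > 1"
  shows "(\<Sum>k\<in>totatives n. gcd (k - 1) n) = totient n * card {d. d dvd n}"
proof -
  have fin: "finite {d. d dvd n}"
    using assms by simp
  \<comment> \<open>Totatives are at least 1, so the natural subtraction \<open>k - 1\<close> does
    not truncate.\<close>
  have dvd_iff: "d dvd gcd (k - 1) n \<longleftrightarrow> d dvd n \<and> [k = 1] (mod d)" if "k \<in> totatives n" for k d
    using that cong_altdef_nat[of 1 k d] by (auto simp: in_totatives_iff)
  have "(\<Sum>k\<in>totatives n. gcd (k - 1) n) = (\<Sum>k\<in>totatives n. \<Sum>d | d dvd gcd (k - 1) n. totient d)"
    by (simp only: totient_divisor_sum)
  also have "\<dots> = (\<Sum>k\<in>totatives n. \<Sum>d | d dvd n. if [k = 1] (mod d) then totient d else 0)"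
  proof (rule sum.cong[OF refl])
    fix k assume "k \<in> totatives n"
    then have "{d. d dvd gcd (k - 1) n} = {d \<in> {d. d dvd n}. [k = 1] (mod d)}"
      by (auto simp only: dvd_iff)
    then show "(\<Sum>d | d dvd gcd (k - 1) n. totient d) = (\<Sum>d | d dvd n. if [k = 1] (mod d) then totient d else 0)"
      by (simp only: sum.inter_filter[OF fin])
  qed
  also have "\<dots> = (\<Sum>d | d dvd n. \<Sum>k\<in>totatives n. if [k = 1] (mod d) then totient d else 0)"
    by (rule sum.swap)
  \<comment> \<open>After the swap, each d contributes phi(d) times the size of the fibre over 1,
    which is phi(n) whatever d is.\<close>
  also have "\<dots> = (\<Sum>d | d dvd n. totient d * card {k \<in> totatives n. [k = 1] (mod d)})"
    by (simp add: sum.inter_filter[symmetric] mult.commute)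
  also have "\<dots> = (\<Sum>d | d dvd n. totient n)"
    using assms by (intro sum.cong totient_mult_card_totatives_cong_1) auto
  finally show ?thesis
    by simp
qed

section \<open>Cosine sums over roots of unity and the denominator\<close>

lemma sum_cos_roots_unity:
  assumes "n > 0"
  shows "(\<Sum>k = 1..n. cos (2 * real k * pi / real n)) = (if n = 1 then 1 else 0)"
proof (cases "n = 1")
  case False
  \<comment> \<open>The cosines are the real parts of the n-th roots of unity, whose sum vanishes
    for n > 1.\<close>
  have "(\<Sum>k<n. cis (2 * pi * real k / real n)) = \<Sum>{z::complex. z ^ n = 1}"
    using bij_betw_roots_unity[OF assms] by (rule sum.reindex_bij_betw)
  also have "\<dots> = 0"
    using False assms by (intro sum_roots_unity) auto
  finally have "(\<Sum>k<n. cos (2 * pi * real k / real n)) = 0"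
    by (metis (mono_tags, lifting) Re_sum cis.sel(1) sum.cong zero_complex.sel(1))
  \<comment> \<open>The index n takes the place of 0; both have cosine 1.\<close>
  moreover have "(\<Sum>k = 1..n. cos (2 * real k * pi / real n)) = (\<Sum>k<n. cos (2 * pi * real k / real n))"
    using assms by (intro sum.reindex_bij_witness[of _ "\<lambda>k. if k = 0 then n else k" "\<lambda>k. if k = n then 0 else k"])
      (auto simp: mult_ac)
  ultimately show ?thesis
    using False by simp
qed simp

text \<open>With g = gcd(j,n) and n = m g, the surviving indices are k = m i for 1 \<le> i \<le> g.
  Their angles are 2 pi i / g, so the sum runs over the g-th roots of unity.\<close>

lemma sum_cos_dvd_mult:
  assumes "n > 0"
  shows "(\<Sum>k = 1..n. if n dvd j * k then cos (2 * real k * pi / real n) else 0) = of_bool (coprime j n)"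
proof -
  define g where "g = gcd j n"
  obtain m j' where m: "n = m * g" "j = j' * g" "coprime j' m"
    using assms gcd_coprime_exists[of j n] unfolding g_def by auto
  have pos: "g > 0" "m > 0"
    using assms m(1) by auto
  have dvd_iff: "n dvd j * k \<longleftrightarrow> m dvd k" for k
  proof -
    have "j * k = (j' * k) * g"
      by (simp only: m(2) mult_ac)
    then have "n dvd j * k \<longleftrightarrow> m dvd j' * k"
      using m(1) pos by (simp only: nat_mult_dvd_cancel_disj mult.commute[of _ g]) simp
    then show ?thesis
      using m(3) by (simp add: coprime_dvd_mult_right_iff coprime_commute)
  qed
  have "(\<Sum>k = 1..n. if n dvd j * k then cos (2 * real k * pi / real n) else 0)
      = (\<Sum>k | k \<in> {1..n} \<and> m dvd k. cos (2 * real k * pi / real n))"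
    by (simp only: dvd_iff sum.inter_filter[OF finite_atLeastAtMost])
  also have "\<dots> = (\<Sum>i = 1..g. cos (2 * real i * pi / real g))"
    using pos by (intro sum.reindex_bij_witness[of _ "\<lambda>i. m * i" "\<lambda>k. k div m"])
      (auto simp: m(1) mult.assoc elim!: dvdE)
  finally show ?thesis
    using sum_cos_roots_unity[OF pos(1)] by (simp only: g_def coprime_iff_gcd_eq_1 of_bool_def)
qed

text \<open>With x = jk/n the second argument is j - x, whose floor is j minus the ceiling of x.
  Floor and ceiling of x differ by 1 unless x is an integer, that is, unless n divides jk.\<close>

lemma floor_add_floor_reflect:
  assumes "n > 0" "k \<le> n"
  shows "\<lfloor>real j * real k / real n\<rfloor> + \<lfloor>real j * real (n - k) / real n\<rfloor>
    = int j - 1 + of_bool (n dvd j * k)"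
proof -
  define x where "x = real j * real k / real n"
  have "real j * real (n - k) / real n = real_of_int (int j) + - x"
    using assms by (simp add: x_def of_nat_diff field_simps)
  then have "\<lfloor>real j * real (n - k) / real n\<rfloor> = int j - \<lceil>x\<rceil>"
    by (simp only: int_add_floor[symmetric] ceiling_def)
  moreover have "x \<in> \<int> \<longleftrightarrow> n dvd j * k"
  proof
    assume "x \<in> \<int>"
    then obtain z where "x = of_int z"
      by (auto elim: Ints_cases)
    then have "real_of_int (int (j * k)) = real_of_int (z * int n)"
      using assms by (simp add: x_def field_simps)
    then have "int (j * k) = z * int n"
      by (simp only: of_int_eq_iff)
    then show "n dvd j * k"
      by (metis dvd_triv_right int_dvd_int_iff)
  next
    assume "n dvd j * k"
    then obtain q where "j * k = n * q" ..
    then have "x = real q"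
      using assms unfolding x_def by (metis less_numeral_extra(3) nonzero_mult_div_cancel_left of_nat_0_eq_iff of_nat_mult)
    then show "x \<in> \<int>"
      by simp
  qed
  ultimately show ?thesis
    unfolding x_def[symmetric] by (auto simp: ceiling_altdef Ints_def)
qed

lemma sum_floor_cos:
  assumes "n > 1"
  shows "2 * (\<Sum>k = 1..n. real_of_int \<lfloor>real j * real k / real n\<rfloor> * cos (2 * real k * pi / real n))
    = real j + of_bool (coprime j n)"
proof -
  let ?c = "\<lambda>k. cos (2 * real k * pi / real n)"
  let ?f = "\<lambda>k. \<lfloor>real j * real k / real n\<rfloor>"
  \<comment> \<open>Including k = 0 makes the range symmetric under k -> n - k; the added term is
    zero because its floor is.\<close>
  let ?S = "\<Sum>k = 0..n. real_of_int (?f k) * ?c k"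
  have split0: "(\<Sum>k = 0..n. h k) = h 0 + (\<Sum>k = 1..n. h k)" for h :: "nat \<Rightarrow> real"
    by (simp add: sum.atLeast_Suc_atMost)
  have c: "?c (n - k) = ?c k" if "k \<le> n" for k
  proof -
    have "2 * real (n - k) * pi / real n = 2 * pi - 2 * real k * pi / real n"
      using that assms by (simp add: of_nat_diff field_simps)
    then show ?thesis
      by (simp add: cos_diff)
  qed
  have "?S = (\<Sum>k = 0..n. real_of_int (?f (n - k)) * ?c (n - k))"
    using sum.atLeastAtMost_rev[of "\<lambda>k. real_of_int (?f k) * ?c k" 0 n] by simp
  also have "\<dots> = (\<Sum>k = 0..n. real_of_int (?f (n - k)) * ?c k)"
    by (intro sum.cong refl) (simp only: c atLeastAtMost_iff)
  finally have "2 * ?S = (\<Sum>k = 0..n. real_of_int (?f k + ?f (n - k)) * ?c k)"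
    by (simp add: sum.distrib ring_distribs)
  also have "\<dots> = (\<Sum>k = 0..n. (real j - 1) * ?c k + (if n dvd j * k then ?c k else 0))"
  proof (intro sum.cong refl)
    fix k assume "k \<in> {0..n}"
    then have "?f k + ?f (n - k) = int j - 1 + of_bool (n dvd j * k)"
      using assms by (intro floor_add_floor_reflect) auto
    then show "real_of_int (?f k + ?f (n - k)) * ?c k
        = (real j - 1) * ?c k + (if n dvd j * k then ?c k else 0)"
      by (simp only:) (simp add: ring_distribs)
  qed
  also have "\<dots> = (real j - 1) * (\<Sum>k = 0..n. ?c k) + (\<Sum>k = 0..n. if n dvd j * k then ?c k else 0)"
    by (simp add: sum.distrib sum_distrib_left)
  \<comment> \<open>The term k = 0 adds 1 to this sum and to the next, as n divides 0. The sum of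
    cosines over 1..n is 0, so the total is (j - 1) + 1 + [gcd(j,n) = 1].\<close>
  also have "(\<Sum>k = 0..n. ?c k) = 1"
    using assms sum_cos_roots_unity[of n] by (simp add: split0)
  also have "(\<Sum>k = 0..n. if n dvd j * k then ?c k else 0) = 1 + of_bool (coprime j n)"
    using assms sum_cos_dvd_mult[of n j] by (simp add: split0)
  finally show ?thesis
    by (simp add: split0)
qed

text \<open>Summing j + [gcd(j,n) = 1] over j, the first part gives n(n-1)/2, which is subtracted,
  and the second counts the totatives of n.\<close>

lemma sum_sum_floor_cos:
  assumes "n > 1"
  shows "2 * (\<Sum>j = 1..n - 1. \<Sum>k = 1..n.
            real_of_int \<lfloor>real j * real k / real n\<rfloor> * cos (2 * real k * pi / real n))
      - real n * (real n - 1) / 2 = real (totient n)"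
proof -
  \<comment> \<open>Stopping at n - 1 loses no totative, because n is not coprime to itself for n >
    1.\<close>
  have "totatives n = {j \<in> {1..n - 1}. coprime j n}"
  proof (intro set_eqI iffI)
    fix j assume "j \<in> totatives n"
    with assms totatives_less[of j n] show "j \<in> {j \<in> {1..n - 1}. coprime j n}"
      by (simp add: in_totatives_iff)
  qed (auto simp: in_totatives_iff)
  then have "(\<Sum>j = 1..n - 1. of_bool (coprime j n)) = real (totient n)"
    by (simp add: totient_def of_bool_def sum.inter_filter[symmetric])
  moreover have "(\<Sum>j = 1..m. real j) = real m * (real m + 1) / 2" for m
    by (induction m) (auto simp: field_simps)
  then have "(\<Sum>j = 1..n - 1. real j) = real n * (real n - 1) / 2"
    using assms by (simp add: of_nat_diff)
  ultimately show ?thesis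
    by (subst sum_distrib_left) (simp only: sum_floor_cos[OF assms] sum.distrib)
qed

text \<open>The quotient is phi(n) tau(n) / phi(n). The case n = 1 is excluded because the double
  sum is then empty and the denominator is 0, while tau(1) = 1.\<close>

theorem mainTheorem6:
  fixes n :: nat
  assumes "n \<ge> 2"
  shows "real (tau n) =
    real (\<Sum>k | k \<in> {1..n} \<and> gcd k n = 1. gcd (k - 1) n) /
    (2 * (\<Sum>j = 1..n - 1. \<Sum>k = 1..n.
            real_of_int \<lfloor>real j * real k / real n\<rfloor> * cos (2 * real k * pi / real n))
      - real n * (real n - 1) / 2)"
proof -
  have n: "n > 1"
    using assms by simp
  have "{k. k \<in> {1..n} \<and> gcd k n = 1} = totatives n"
    by (auto simp: in_totatives_iff coprime_iff_gcd_eq_1 simp del: coprime_imp_gcd_eq_1)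
  moreover have "tau n = card {d. d dvd n}"
    by (simp add: tau_def)
  moreover have "totient n > 0"
    using n by simp
  ultimately show ?thesis
    unfolding sum_sum_floor_cos[OF n] by (simp only: menon_identity[OF n]) simp
qed

end
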